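(* Let $\Omega$ be a locally compact Hausdorff space and let $K$ be a pseudocone in $M(\Omega)$. Let $\widetilde K=\{\mu_E:\ \mu\in K,\ E\subseteq\Omega\text{ Borel}\}$. If there exists a sequence $\{E_n\}_{n\in\mathbb{N}}$ of mutually disjoint Borel subsets of $\Omega$ such that for all $n$ $$\{\mu_{E_n}:\ \mu\in\widetilde K\}\neq\{\mu_{E_n}:\ \mu\in M(\Omega)\},$$ then $M(\Omega)\setminus\widetilde K$ (and consequently $M(\Omega)\setminus K$) is spaceable in $M(\Omega)$.
   Context: $M(\Omega)$ is the Banach space of all (complex) Radon measures on $\Omega$ equipped with the total variation norm. A subset $B$ of a vector space is called a pseudocone if $cB\subseteq B$ for each scalar $c$. For a Borel set $E\subseteq\Omega$ and $\mu\in M(\Omega)$, $\mu_E\in M(\Omega)$ is the measure given by $\mu_E(B)=\mu(B\cap E)$ for every Borel subset $B$ of $\Omega$. A subset $S$ of a Banach space $Y$ is called spaceable in $Y$ if $S\cup\{0\}$ contains a closed infinite-dimensional linear subspace of $Y$.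
   Formalization: The pseudocone K is assumed non-empty; for K empty the literal statement fails, e.g. for Ω a single point and all E_n empty, where M(Ω) is one-dimensional. *)

theory Defs
  imports "HOL-Analysis.Analysis"
begin

section \<open>Complex Radon measures\<close>

text \<open>
  A complex Borel measure is a countably additive complex-valued function on the Borel sets.
  Requiring the value 0 off the Borel sets makes the representing set function unique, so that
  equality of measures is equality of functions.
\<close>

definition complex_measure :: "('a::topological_space set \<Rightarrow> complex) \<Rightarrow> bool" where
  "complex_measure \<mu> \<longleftrightarrow>
     (\<forall>B. B \<notin> sets borel \<longrightarrow> \<mu> B = 0) \<and>
     (\<forall>A. range A \<subseteq> sets borel \<longrightarrow> disjoint_family A \<longrightarrow>
        (\<lambda>n::nat. \<mu> (A n)) sums \<mu> (\<Union>n. A n))"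

definition borel_partitions :: "'a::topological_space set \<Rightarrow> 'a set set set" where
  "borel_partitions B = {P. finite P \<and> P \<subseteq> sets borel \<and> disjoint P \<and> \<Union>P = B}"

definition variation :: "('a::topological_space set \<Rightarrow> complex) \<Rightarrow> 'a set \<Rightarrow> ennreal" where
  "variation \<mu> B = (SUP P\<in>borel_partitions B. \<Sum>A\<in>P. ennreal (cmod (\<mu> A)))"

text \<open>
  The total variation of a complex measure is finite, so inner regularity on all Borel sets
  also gives outer regularity, by passing to complements. By countable additivity, finite
  partitions yield the same variation as countable ones.
\<close>

definition complex_radon :: "('a::t2_space set \<Rightarrow> complex) \<Rightarrow> bool" where
  "complex_radon \<mu> \<longleftrightarrow> complex_measure \<mu> \<and>
     (\<forall>B\<in>sets borel. variation \<mu> B = (SUP C\<in>{C. compact C \<and> C \<subseteq> B}. variation \<mu> C))"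

lemma complex_measure_empty:
  assumes "complex_measure \<mu>" shows "\<mu> {} = 0"
proof -
  have "(\<lambda>n::nat. \<mu> {}) sums \<mu> (\<Union>n::nat. {})"
    using assms unfolding complex_measure_def
    by (elim conjE allE[of _ "\<lambda>n. {}"]) (auto simp: disjoint_family_on_def)
  then have "(\<lambda>n::nat. \<mu> {}) \<longlonglongrightarrow> 0"
    using summable_LIMSEQ_zero sums_summable by blast
  then show ?thesis by (simp add: LIMSEQ_const_iff)
qed

lemma complex_measure_Un:
  assumes "complex_measure \<mu>" "A \<in> sets borel" "B \<in> sets borel" "A \<inter> B = {}"
  shows "\<mu> (A \<union> B) = \<mu> A + \<mu> B"
proof -
  have "range (binaryset A B) \<subseteq> sets borel" "disjoint_family (binaryset A B)"
    using assms by (auto simp: binaryset_def disjoint_family_on_def)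
  then have "(\<lambda>n. \<mu> (binaryset A B n)) sums \<mu> (\<Union>n. binaryset A B n)"
    using assms(1) unfolding complex_measure_def by blast
  then have "(\<lambda>n. \<mu> (binaryset A B n)) sums \<mu> (A \<union> B)"
    by (simp add: UN_binaryset_eq)
  moreover have "(\<lambda>n. \<mu> (binaryset A B n)) sums (\<mu> A + \<mu> B)"
    by (rule binaryset_sums) (rule complex_measure_empty[OF assms(1)])
  ultimately show ?thesis by (rule sums_unique2)
qed

lemma complex_measure_Union:
  assumes "complex_measure \<mu>" "finite P" "P \<subseteq> sets borel" "disjoint P"
  shows "\<mu> (\<Union>P) = (\<Sum>A\<in>P. \<mu> A)"
  using assms(2-4)
proof (induction P)
  case empty
  then show ?case using complex_measure_empty[OF assms(1)] by simp
next
  case (insert A P)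
  have "A \<inter> \<Union>P = {}"
    using insert.prems(2) insert.hyps(2) by (fastforce simp: disjoint_def)
  moreover have "\<Union>P \<in> sets borel"
    using insert by (intro sets.finite_Union) auto
  moreover have "disjoint P" using insert.prems(2) by (auto simp: disjoint_def)
  ultimately show ?case using insert complex_measure_Un[OF assms(1), of A "\<Union>P"] by auto
qed

lemma complex_measure_bounded:
  fixes \<mu> :: "'a::topological_space set \<Rightarrow> complex"
  assumes "complex_measure \<mu>"
  obtains M where "\<And>B. B \<in> sets borel \<Longrightarrow> cmod (\<mu> B) \<le> M"
proof (rule ccontr)
  assume "\<not> thesis"
  then have unb: "\<exists>B\<in>sets borel. cmod (\<mu> B) > M" for M using that by (meson not_less)
  define bad :: "'a set \<Rightarrow> bool" where
    "bad A \<longleftrightarrow> A \<in> sets borel \<and> (\<forall>M. \<exists>B\<in>sets borel. B \<subseteq> A \<and> cmod (\<mu> B) > M)" for A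
  have step: "\<exists>A'. bad A' \<and> A' \<subseteq> A \<and> cmod (\<mu> (A - A')) > 1" if A: "bad A" for A
  proof -
    obtain B where B: "B \<in> sets borel" "B \<subseteq> A" "cmod (\<mu> B) > cmod (\<mu> A) + 1"
      using A unfolding bad_def by blast
    have Ab: "A \<in> sets borel" using A by (simp add: bad_def)
    have "\<mu> A = \<mu> B + \<mu> (A - B)"
      using complex_measure_Un[OF assms, of B "A - B"] B Ab
      by (simp add: Un_absorb1 sets.Diff)
    then have "\<mu> B = \<mu> A - \<mu> (A - B)" by simp
    then have "cmod (\<mu> B) \<le> cmod (\<mu> A) + cmod (\<mu> (A - B))"
      using norm_triangle_ineq4[of "\<mu> A" "\<mu> (A - B)"] by simp
    then have d: "cmod (\<mu> (A - B)) > 1" using B(3) by linarith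
    have b: "cmod (\<mu> B) > 1" using B(3) norm_ge_zero[of "\<mu> A"] by linarith
    have "bad B \<or> bad (A - B)"
    proof (rule ccontr)
      assume "\<not> ?thesis"
      then obtain M N where
        M: "\<And>C. C \<in> sets borel \<Longrightarrow> C \<subseteq> B \<Longrightarrow> cmod (\<mu> C) \<le> M" and
        N: "\<And>C. C \<in> sets borel \<Longrightarrow> C \<subseteq> A - B \<Longrightarrow> cmod (\<mu> C) \<le> N"
        using B Ab unfolding bad_def by (meson not_less sets.Diff)
      have "cmod (\<mu> C) \<le> M + N" if C: "C \<in> sets borel" "C \<subseteq> A" for C
      proof -
        have "\<mu> ((C \<inter> B) \<union> (C - B)) = \<mu> (C \<inter> B) + \<mu> (C - B)"
          by (rule complex_measure_Un[OF assms]) (use C B in auto)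
        moreover have "(C \<inter> B) \<union> (C - B) = C" by auto
        ultimately have "cmod (\<mu> C) \<le> cmod (\<mu> (C \<inter> B)) + cmod (\<mu> (C - B))"
          using norm_triangle_ineq[of "\<mu> (C \<inter> B)" "\<mu> (C - B)"] by simp
        moreover have "cmod (\<mu> (C \<inter> B)) \<le> M" using C B by (intro M) auto
        moreover have "cmod (\<mu> (C - B)) \<le> N" using C B by (intro N) auto
        ultimately show ?thesis by linarith
      qed
      then show False using A unfolding bad_def by (meson not_less)
    qed
    then show ?thesis
    proof
      assume "bad B" then show ?thesis using B d by blast
    next
      assume "bad (A - B)"
      moreover have "A - (A - B) = B" using B by blast
      ultimately show ?thesis using b by (metis Diff_subset)
    qed
  qed
  have "bad UNIV" using unb by (simp add: bad_def)
  then obtain f where f: "\<And>n::nat. bad (f n)"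
      "\<And>n. f (Suc n) \<subseteq> f n \<and> cmod (\<mu> (f n - f (Suc n))) > 1"
    using dependent_nat_choice[of "\<lambda>_. bad" "\<lambda>_ A A'. A' \<subseteq> A \<and> cmod (\<mu> (A - A')) > 1"]
      step by metis
  have dec: "f m \<subseteq> f n" if "n \<le> m" for m n
    using lift_Suc_antimono_le[of f n m] f(2) that by blast
  define D where "D n = f n - f (Suc n)" for n
  have "D m \<inter> D n = {}" if "m < n" for m n
    using dec[of "Suc m" n] that by (auto simp: D_def)
  then have "disjoint_family D"
    unfolding disjoint_family_on_def by (metis Int_commute nat_neq_iff)
  moreover have "range D \<subseteq> sets borel" using f(1) by (auto simp: D_def bad_def)
  ultimately have "summable (\<lambda>n. \<mu> (D n))"
    using assms unfolding complex_measure_def by (meson sums_summable)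
  then have "(\<lambda>n. cmod (\<mu> (D n))) \<longlonglongrightarrow> 0"
    using summable_LIMSEQ_zero tendsto_norm_zero by blast
  then have "\<forall>\<^sub>F n in sequentially. cmod (\<mu> (D n)) < 1" by (rule order_tendstoD) simp
  then obtain n where "cmod (\<mu> (D n)) < 1" by (auto simp: eventually_sequentially)
  then show False using f(2)[of n] by (simp add: D_def)
qed

lemma complex_measure_sum_bound:
  assumes "complex_measure \<mu>" "\<And>B. B \<in> sets borel \<Longrightarrow> cmod (\<mu> B) \<le> M"
    and P: "finite P" "P \<subseteq> sets borel" "disjoint P"
  shows "(\<Sum>A\<in>P. cmod (\<mu> A)) \<le> 4 * M"
proof -
  have part: "cmod (\<Sum>A\<in>{A\<in>P. Q A}. \<mu> A) \<le> M" for Q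
  proof -
    have "(\<Sum>A\<in>{A\<in>P. Q A}. \<mu> A) = \<mu> (\<Union>{A\<in>P. Q A})"
      by (rule complex_measure_Union[symmetric, OF assms(1)])
        (use P in \<open>auto simp: disjoint_def\<close>)
    moreover have "\<Union>{A\<in>P. Q A} \<in> sets borel"
      using P by (intro sets.finite_Union) auto
    ultimately show ?thesis using assms(2) by simp
  qed
  have half: "(\<Sum>A\<in>P. \<bar>g (\<mu> A)\<bar>) \<le> 2 * M"
    if g: "\<And>F. g (\<Sum>A\<in>F. \<mu> A) = (\<Sum>A\<in>F. g (\<mu> A))" "\<And>z. \<bar>g z\<bar> \<le> cmod z" for g
  proof -
    have "(\<Sum>A\<in>P. \<bar>g (\<mu> A)\<bar>) =
        (\<Sum>A\<in>{A\<in>P. g (\<mu> A) \<ge> 0}. \<bar>g (\<mu> A)\<bar>) + (\<Sum>A\<in>{A\<in>P. \<not> g (\<mu> A) \<ge> 0}. \<bar>g (\<mu> A)\<bar>)"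
      using P(1) by (subst sum.union_disjoint[symmetric]) (auto intro!: sum.cong)
    also have "\<dots> = (\<Sum>A\<in>{A\<in>P. g (\<mu> A) \<ge> 0}. g (\<mu> A)) - (\<Sum>A\<in>{A\<in>P. \<not> g (\<mu> A) \<ge> 0}. g (\<mu> A))"
      by (simp add: sum_negf[symmetric] diff_conv_add_uminus del: add_uminus_conv_diff)
    also have "\<dots> \<le> M + M"
      using part[of "\<lambda>A. g (\<mu> A) \<ge> 0"] part[of "\<lambda>A. \<not> g (\<mu> A) \<ge> 0"]
        g(2)[of "\<Sum>A\<in>{A\<in>P. g (\<mu> A) \<ge> 0}. \<mu> A"] g(2)[of "\<Sum>A\<in>{A\<in>P. \<not> g (\<mu> A) \<ge> 0}. \<mu> A"]
      unfolding g(1) by linarith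
    finally show ?thesis by simp
  qed
  have "(\<Sum>A\<in>P. cmod (\<mu> A)) \<le> (\<Sum>A\<in>P. \<bar>Re (\<mu> A)\<bar> + \<bar>Im (\<mu> A)\<bar>)"
    by (intro sum_mono cmod_le)
  also have "\<dots> \<le> 2 * M + 2 * M"
    unfolding sum.distrib by (intro add_mono half) (auto simp: abs_Re_le_cmod abs_Im_le_cmod)
  finally show ?thesis by simp
qed

lemma variation_finite:
  assumes "complex_measure \<mu>" shows "variation \<mu> B < \<infinity>"
proof -
  obtain M where M: "\<And>B. B \<in> sets borel \<Longrightarrow> cmod (\<mu> B) \<le> M"
    using complex_measure_bounded[OF assms] by blast
  have "variation \<mu> B \<le> ennreal (4 * M)"
    unfolding variation_def
  proof (rule SUP_least)
    fix P assume "P \<in> borel_partitions B"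
    then have "(\<Sum>A\<in>P. cmod (\<mu> A)) \<le> 4 * M"
      using complex_measure_sum_bound[OF assms M] by (auto simp: borel_partitions_def)
    then show "(\<Sum>A\<in>P. ennreal (cmod (\<mu> A))) \<le> ennreal (4 * M)"
      by (simp add: sum_ennreal ennreal_leI)
  qed
  then show ?thesis using ennreal_less_top le_less_trans by fastforce
qed

lemma cmod_le_variation:
  assumes "B \<in> sets borel" shows "ennreal (cmod (\<mu> B)) \<le> variation \<mu> B"
  unfolding variation_def
  by (rule SUP_upper2[of "{B}"]) (use assms in \<open>auto simp: borel_partitions_def\<close>)

lemma variation_add_le: "variation (\<lambda>B. \<mu> B + \<nu> B) B \<le> variation \<mu> B + variation \<nu> B"
  unfolding variation_def[of "\<lambda>B. \<mu> B + \<nu> B"]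
proof (rule SUP_least)
  fix P assume P: "P \<in> borel_partitions B"
  have "(\<Sum>A\<in>P. ennreal (cmod (\<mu> A + \<nu> A))) \<le> (\<Sum>A\<in>P. ennreal (cmod (\<mu> A)) + ennreal (cmod (\<nu> A)))"
    by (intro sum_mono) (simp add: ennreal_plus[symmetric] ennreal_leI norm_triangle_ineq del: ennreal_plus)
  also have "\<dots> \<le> variation \<mu> B + variation \<nu> B"
    unfolding sum.distrib variation_def by (intro add_mono SUP_upper P)
  finally show "(\<Sum>A\<in>P. ennreal (cmod (\<mu> A + \<nu> A))) \<le> variation \<mu> B + variation \<nu> B" .
qed

lemma variation_scale: "variation (\<lambda>B. c * \<mu> B) B = ennreal (cmod c) * variation \<mu> B"
  unfolding variation_def
  by (simp add: norm_mult ennreal_mult sum_distrib_left[symmetric] SUP_mult_left_ennreal)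

lemma variation_mono:
  assumes "A \<subseteq> B" "A \<in> sets borel" "B \<in> sets borel"
  shows "variation \<mu> A \<le> variation \<mu> B"
  unfolding variation_def[of \<mu> A]
proof (rule SUP_least)
  fix P assume P: "P \<in> borel_partitions A"
  have "insert (B - A) P \<in> borel_partitions B"
    using P assms by (auto simp: borel_partitions_def disjoint_def)
  then have "(\<Sum>A\<in>insert (B - A) P. ennreal (cmod (\<mu> A))) \<le> variation \<mu> B"
    unfolding variation_def by (rule SUP_upper)
  moreover have "(\<Sum>A\<in>P. ennreal (cmod (\<mu> A))) \<le> (\<Sum>A\<in>insert (B - A) P. ennreal (cmod (\<mu> A)))"
    using P by (intro sum_mono2) (auto simp: borel_partitions_def)
  ultimately show "(\<Sum>A\<in>P. ennreal (cmod (\<mu> A))) \<le> variation \<mu> B" by order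
qed

lemma variation_Un:
  assumes \<mu>: "complex_measure \<mu>" and A: "A \<in> sets borel" and B: "B \<in> sets borel" and AB: "A \<inter> B = {}"
  shows "variation \<mu> (A \<union> B) = variation \<mu> A + variation \<mu> B"
proof (rule antisym)
  let ?s = "\<lambda>P. \<Sum>A\<in>P. ennreal (cmod (\<mu> A))"
  have restr: "(\<Sum>X\<in>P. ennreal (cmod (\<mu> (X \<inter> C)))) \<le> variation \<mu> C"
    if P: "P \<in> borel_partitions (A \<union> B)" and C: "C \<in> sets borel" "C \<subseteq> A \<union> B" for P C
  proof -
    have "(\<lambda>X. X \<inter> C) ` P \<in> borel_partitions C"
      unfolding borel_partitions_def
    proof (intro CollectI conjI)
      have "disjoint P" using P by (simp add: borel_partitions_def)
      then have "X \<inter> Y = {} \<or> X = Y" if "X \<in> P" "Y \<in> P" for X Y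
        using that by (auto simp: disjoint_def)
      then show "disjoint ((\<lambda>X. X \<inter> C) ` P)" unfolding disjoint_def by blast
      have "\<Union>P = A \<union> B" using P by (simp add: borel_partitions_def)
      then show "\<Union>((\<lambda>X. X \<inter> C) ` P) = C" using C by blast
    qed (use P C in \<open>auto simp: borel_partitions_def\<close>)
    then have "?s ((\<lambda>X. X \<inter> C) ` P) \<le> variation \<mu> C"
      unfolding variation_def by (rule SUP_upper)
    moreover have "?s ((\<lambda>X. X \<inter> C) ` P) = (\<Sum>X\<in>P. ennreal (cmod (\<mu> (X \<inter> C))))"
    proof (subst sum.reindex_nontrivial)
      show "finite P" using P by (simp add: borel_partitions_def)
      fix X Y assume XY: "X \<in> P" "Y \<in> P" "X \<noteq> Y" "X \<inter> C = Y \<inter> C"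
      then have "X \<inter> Y = {}" using P by (auto simp: borel_partitions_def disjoint_def)
      then have "X \<inter> C = {}" using XY(4) by blast
      then show "ennreal (cmod (\<mu> (X \<inter> C))) = 0" using complex_measure_empty[OF \<mu>] by simp
    qed simp
    ultimately show ?thesis by simp
  qed
  show "variation \<mu> (A \<union> B) \<le> variation \<mu> A + variation \<mu> B"
    unfolding variation_def[of \<mu> "A \<union> B"]
  proof (rule SUP_least)
    fix P assume P: "P \<in> borel_partitions (A \<union> B)"
    have "?s P \<le> (\<Sum>X\<in>P. ennreal (cmod (\<mu> (X \<inter> A))) + ennreal (cmod (\<mu> (X \<inter> B))))"
    proof (rule sum_mono)
      fix X assume "X \<in> P"
      then have X: "X \<in> sets borel" "X \<subseteq> A \<union> B" using P by (auto simp: borel_partitions_def)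
      then have "\<mu> ((X \<inter> A) \<union> (X \<inter> B)) = \<mu> (X \<inter> A) + \<mu> (X \<inter> B)"
        using A B AB by (intro complex_measure_Un[OF \<mu>]) auto
      moreover have "(X \<inter> A) \<union> (X \<inter> B) = X" using X by blast
      ultimately show "ennreal (cmod (\<mu> X)) \<le> ennreal (cmod (\<mu> (X \<inter> A))) + ennreal (cmod (\<mu> (X \<inter> B)))"
        by (simp add: ennreal_plus[symmetric] ennreal_leI norm_triangle_ineq del: ennreal_plus)
    qed
    also have "\<dots> \<le> variation \<mu> A + variation \<mu> B"
      unfolding sum.distrib using P A B by (intro add_mono restr) auto
    finally show "?s P \<le> variation \<mu> A + variation \<mu> B" .
  qed
  have ne: "borel_partitions C \<noteq> {}" if "C \<in> sets borel" for C :: "'a set"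
  proof -
    have "{C} \<in> borel_partitions C" using that by (auto simp: borel_partitions_def)
    then show ?thesis by blast
  qed
  have "?s P + ?s Q \<le> variation \<mu> (A \<union> B)"
    if P: "P \<in> borel_partitions A" and Q: "Q \<in> borel_partitions B" for P Q
  proof -
    have fin: "finite P" "finite Q" using P Q by (auto simp: borel_partitions_def)
    have "X = {}" if "X \<in> P \<inter> Q" for X
    proof -
      have "X \<subseteq> A" "X \<subseteq> B" using that P Q by (auto simp: borel_partitions_def)
      then show ?thesis using AB by blast
    qed
    then have "?s (P \<inter> Q) = 0"
      using complex_measure_empty[OF \<mu>] fin by (intro sum.neutral) auto
    then have "?s P + ?s Q = ?s (P \<union> Q)"
      using sum.union_inter[OF fin, of "\<lambda>A. ennreal (cmod (\<mu> A))"] by simp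
    moreover have "P \<union> Q \<in> borel_partitions (A \<union> B)"
      using P Q AB disjoint_union[of P Q] unfolding borel_partitions_def by simp
    ultimately show ?thesis unfolding variation_def by (simp only: SUP_upper)
  qed
  then have "variation \<mu> A + ?s Q \<le> variation \<mu> (A \<union> B)" if "Q \<in> borel_partitions B" for Q
    unfolding variation_def[of \<mu> A] ennreal_SUP_add_left[OF ne[OF A], symmetric]
    using that by (intro SUP_least) auto
  then show "variation \<mu> A + variation \<mu> B \<le> variation \<mu> (A \<union> B)"
    unfolding variation_def[of \<mu> B] ennreal_SUP_add_right[OF ne[OF B]]
    by (intro SUP_least) auto
qed

lemma complex_radonI:
  assumes \<mu>: "complex_measure \<mu>"
    and approx: "\<And>B e. B \<in> sets borel \<Longrightarrow> (0::real) < e \<Longrightarrow>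
      \<exists>C. compact C \<and> C \<subseteq> B \<and> variation \<mu> (B - C) \<le> ennreal e"
  shows "complex_radon \<mu>"
  unfolding complex_radon_def
proof (intro conjI ballI antisym \<mu>)
  fix B :: "'a set" assume B: "B \<in> sets borel"
  show "variation \<mu> B \<le> (SUP C\<in>{C. compact C \<and> C \<subseteq> B}. variation \<mu> C)"
  proof (rule ennreal_le_epsilon)
    fix e :: real assume "0 < e"
    then obtain C where C: "compact C" "C \<subseteq> B" "variation \<mu> (B - C) \<le> ennreal e"
      using approx B by blast
    have "C \<in> sets borel" using C(1) by (simp add: borel_compact)
    then have "variation \<mu> (C \<union> (B - C)) = variation \<mu> C + variation \<mu> (B - C)"
      using B by (intro variation_Un[OF \<mu>]) auto
    moreover have "C \<union> (B - C) = B" using C by blast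
    ultimately have "variation \<mu> B = variation \<mu> C + variation \<mu> (B - C)" by simp
    also have "\<dots> \<le> (SUP C\<in>{C. compact C \<and> C \<subseteq> B}. variation \<mu> C) + ennreal e"
      using C by (intro add_mono SUP_upper) auto
    finally show "variation \<mu> B \<le> (SUP C\<in>{C. compact C \<and> C \<subseteq> B}. variation \<mu> C) + ennreal e" .
  qed
  show "(SUP C\<in>{C. compact C \<and> C \<subseteq> B}. variation \<mu> C) \<le> variation \<mu> B"
    using B by (intro SUP_least variation_mono) (auto intro: borel_compact)
qed

lemma complex_radonD:
  assumes "complex_radon \<mu>" "B \<in> sets borel" "(0::real) < e"
  shows "\<exists>C. compact C \<and> C \<subseteq> B \<and> variation \<mu> (B - C) \<le> ennreal e"
proof -
  have \<mu>: "complex_measure \<mu>" using assms(1) by (simp add: complex_radon_def)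
  have fin: "variation \<mu> B < \<infinity>" by (rule variation_finite[OF \<mu>])
  have "variation \<mu> B = (SUP C\<in>{C. compact C \<and> C \<subseteq> B}. variation \<mu> C)"
    using assms by (simp add: complex_radon_def)
  then have "\<exists>C\<in>{C. compact C \<and> C \<subseteq> B}. variation \<mu> B < variation \<mu> C + ennreal e"
    using fin assms(3) SUP_approx_ennreal[of e "{C. compact C \<and> C \<subseteq> B}" "variation \<mu> B" "variation \<mu>"]
    by (metis (mono_tags, lifting) compact_empty empty_iff empty_subsetI ennreal_less_zero_iff
        infinity_ennreal_def mem_Collect_eq order_less_irrefl)
  then obtain C where C: "compact C" "C \<subseteq> B" "variation \<mu> B < variation \<mu> C + ennreal e" by blast
  have "C \<in> sets borel" using C(1) by (simp add: borel_compact)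
  then have "variation \<mu> (C \<union> (B - C)) = variation \<mu> C + variation \<mu> (B - C)"
    using assms(2) by (intro variation_Un[OF \<mu>]) auto
  moreover have "C \<union> (B - C) = B" using C by blast
  ultimately have "variation \<mu> C + variation \<mu> (B - C) < variation \<mu> C + ennreal e"
    using C(3) by simp
  then have "variation \<mu> (B - C) \<le> ennreal e"
    by (metis add_left_mono not_le order_less_imp_le)
  then show ?thesis using C by blast
qed

lemma complex_measure_zero: "complex_measure (\<lambda>_. 0)"
  by (simp add: complex_measure_def)

lemma complex_measure_add:
  "complex_measure \<mu> \<Longrightarrow> complex_measure \<nu> \<Longrightarrow> complex_measure (\<lambda>B. \<mu> B + \<nu> B)"
  by (simp add: complex_measure_def sums_add)

lemma complex_measure_scale: "complex_measure \<mu> \<Longrightarrow> complex_measure (\<lambda>B. c * \<mu> B)"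
  by (simp add: complex_measure_def sums_mult)

lemma complex_radon_scale:
  assumes "complex_radon \<mu>" shows "complex_radon (\<lambda>B. c * \<mu> B)"
  using assms unfolding complex_radon_def variation_scale
  by (simp add: complex_measure_scale SUP_mult_left_ennreal)

lemma complex_radon_zero: "complex_radon (\<lambda>_. 0)"
proof (rule complex_radonI[OF complex_measure_zero])
  fix B :: "'a set" and e :: real
  show "\<exists>C. compact C \<and> C \<subseteq> B \<and> variation (\<lambda>_. 0) (B - C) \<le> ennreal e"
    using variation_scale[of 0 "\<lambda>_. 0" B] by (intro exI[of _ "{}"]) simp
qed

lemma complex_radon_add:
  assumes "complex_radon \<mu>" "complex_radon \<nu>" shows "complex_radon (\<lambda>B. \<mu> B + \<nu> B)"
proof (rule complex_radonI)
  have m: "complex_measure \<mu>" "complex_measure \<nu>" using assms by (auto simp: complex_radon_def)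
  then show "complex_measure (\<lambda>B. \<mu> B + \<nu> B)" by (rule complex_measure_add)
  fix B :: "'a set" and e :: real assume B: "B \<in> sets borel" and e: "0 < e"
  obtain C where C: "compact C" "C \<subseteq> B" "variation \<mu> (B - C) \<le> ennreal (e / 2)"
    using complex_radonD[OF assms(1) B, of "e / 2"] e by auto
  obtain D where D: "compact D" "D \<subseteq> B" "variation \<nu> (B - D) \<le> ennreal (e / 2)"
    using complex_radonD[OF assms(2) B, of "e / 2"] e by auto
  have CD: "C \<in> sets borel" "D \<in> sets borel" using C(1) D(1) by (simp_all add: borel_compact)
  have "variation (\<lambda>B. \<mu> B + \<nu> B) (B - (C \<union> D)) \<le>
      variation \<mu> (B - (C \<union> D)) + variation \<nu> (B - (C \<union> D))" by (rule variation_add_le)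
  also have "\<dots> \<le> variation \<mu> (B - C) + variation \<nu> (B - D)"
    using B CD by (intro add_mono variation_mono) auto
  also have "\<dots> \<le> ennreal (e / 2) + ennreal (e / 2)" using C D by (intro add_mono)
  also have "\<dots> = ennreal e" using e by (simp add: ennreal_plus[symmetric] del: ennreal_plus)
  finally show "\<exists>C. compact C \<and> C \<subseteq> B \<and> variation (\<lambda>B. \<mu> B + \<nu> B) (B - C) \<le> ennreal e"
    using C D by (intro exI[of _ "C \<union> D"]) auto
qed

lemma complex_radon_restrict:
  assumes \<mu>: "complex_radon \<mu>" and E: "E \<in> sets borel"
  shows "complex_radon (\<lambda>B. if B \<in> sets borel then \<mu> (B \<inter> E) else 0)" (is "complex_radon ?\<nu>")
proof (rule complex_radonI)
  have m: "complex_measure \<mu>" using \<mu> by (simp add: complex_radon_def)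
  show cm: "complex_measure ?\<nu>"
    unfolding complex_measure_def
  proof (intro conjI allI impI)
    fix A :: "nat \<Rightarrow> 'a set" assume A: "range A \<subseteq> sets borel" "disjoint_family A"
    have "range (\<lambda>n. A n \<inter> E) \<subseteq> sets borel" "disjoint_family (\<lambda>n. A n \<inter> E)"
      using A E by (auto simp: disjoint_family_on_def)
    then have "(\<lambda>n. \<mu> (A n \<inter> E)) sums \<mu> (\<Union>n. A n \<inter> E)"
      using m unfolding complex_measure_def by blast
    moreover have "A n \<in> sets borel" for n using A by auto
    moreover have "(\<Union>n. A n) \<in> sets borel" using A by blast
    ultimately show "(\<lambda>n. ?\<nu> (A n)) sums ?\<nu> (\<Union>n. A n)" by simp
  qed simp
  fix B :: "'a set" and e :: real assume B: "B \<in> sets borel" and e: "0 < e"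
  obtain C where C: "compact C" "C \<subseteq> B" "variation \<mu> (B - C) \<le> ennreal e"
    using complex_radonD[OF \<mu> B e] by auto
  have Cb: "C \<in> sets borel" using C(1) by (simp add: borel_compact)
  have "variation ?\<nu> (B - C) \<le> variation \<mu> (B - C)"
    unfolding variation_def[of ?\<nu>]
  proof (rule SUP_least)
    fix P assume P: "P \<in> borel_partitions (B - C)"
    have fin: "finite P" and bP: "P \<subseteq> sets borel" and dP: "disjoint P" and uP: "\<Union>P = B - C"
      using P by (auto simp: borel_partitions_def)
    let ?D = "(B - C) \<inter> E"
    have "(\<lambda>X. X \<inter> E) ` P \<in> borel_partitions ?D"
      unfolding borel_partitions_def
    proof (intro CollectI conjI)
      have "X \<inter> Y = {} \<or> X = Y" if "X \<in> P" "Y \<in> P" for X Y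
        using that dP by (auto simp: disjoint_def)
      then show "disjoint ((\<lambda>X. X \<inter> E) ` P)" unfolding disjoint_def by blast
      show "\<Union>((\<lambda>X. X \<inter> E) ` P) = ?D" using uP by blast
    qed (use fin bP E in auto)
    then have "(\<Sum>A\<in>(\<lambda>X. X \<inter> E) ` P. ennreal (cmod (\<mu> A))) \<le> variation \<mu> ?D"
      unfolding variation_def by (rule SUP_upper)
    moreover have "(\<Sum>A\<in>(\<lambda>X. X \<inter> E) ` P. ennreal (cmod (\<mu> A))) =
        (\<Sum>X\<in>P. ennreal (cmod (\<mu> (X \<inter> E))))"
    proof (subst sum.reindex_nontrivial[OF fin])
      fix X Y assume XY: "X \<in> P" "Y \<in> P" "X \<noteq> Y" "X \<inter> E = Y \<inter> E"
      then have "X \<inter> Y = {}" using dP by (auto simp: disjoint_def)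
      then have "X \<inter> E = {}" using XY(4) by blast
      then show "ennreal (cmod (\<mu> (X \<inter> E))) = 0" using complex_measure_empty[OF m] by simp
    qed simp
    moreover have "(\<Sum>A\<in>P. ennreal (cmod (?\<nu> A))) = (\<Sum>X\<in>P. ennreal (cmod (\<mu> (X \<inter> E))))"
      using bP by (intro sum.cong) auto
    moreover have "variation \<mu> ?D \<le> variation \<mu> (B - C)"
      using B Cb E by (intro variation_mono) auto
    ultimately show "(\<Sum>A\<in>P. ennreal (cmod (?\<nu> A))) \<le> variation \<mu> (B - C)" by simp
  qed
  then show "\<exists>C. compact C \<and> C \<subseteq> B \<and> variation ?\<nu> (B - C) \<le> ennreal e"
    using C by (intro exI[of _ C]) auto
qed


section \<open>The normed space of complex Radon measures\<close>

typedef (overloaded) 'a radon_measure = "{\<mu> :: 'a::t2_space set \<Rightarrow> complex. complex_radon \<mu>}"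
  morphisms rm_apply Abs_radon_measure
  using complex_radon_zero by blast

setup_lifting type_definition_radon_measure

lemma rm_complex_radon: "complex_radon (rm_apply \<mu>)"
  using rm_apply[of \<mu>] by simp

lemma rm_complex_measure: "complex_measure (rm_apply \<mu>)"
  using rm_complex_radon by (auto simp: complex_radon_def)

lift_definition rm_scale :: "complex \<Rightarrow> 'a::t2_space radon_measure \<Rightarrow> 'a radon_measure"
  is "\<lambda>c \<mu> B. c * \<mu> B"
  by (rule complex_radon_scale)

instantiation radon_measure :: (t2_space) real_normed_vector
begin

lift_definition zero_radon_measure :: "'a radon_measure" is "\<lambda>_. 0"
  by (rule complex_radon_zero)

lift_definition plus_radon_measure :: "'a radon_measure \<Rightarrow> 'a radon_measure \<Rightarrow> 'a radon_measure"
  is "\<lambda>\<mu> \<nu> B. \<mu> B + \<nu> B"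
  by (rule complex_radon_add)

definition uminus_radon_measure :: "'a radon_measure \<Rightarrow> 'a radon_measure" where
  "- \<mu> = rm_scale (- 1) \<mu>"

definition minus_radon_measure :: "'a radon_measure \<Rightarrow> 'a radon_measure \<Rightarrow> 'a radon_measure" where
  "\<mu> - \<nu> = \<mu> + (- \<nu> :: 'a radon_measure)"

definition scaleR_radon_measure :: "real \<Rightarrow> 'a radon_measure \<Rightarrow> 'a radon_measure" where
  "r *\<^sub>R \<mu> = rm_scale (complex_of_real r) \<mu>"

definition norm_radon_measure :: "'a radon_measure \<Rightarrow> real" where
  "norm \<mu> = enn2real (variation (rm_apply \<mu>) UNIV)"

definition dist_radon_measure :: "'a radon_measure \<Rightarrow> 'a radon_measure \<Rightarrow> real" where
  "dist \<mu> \<nu> = norm (\<mu> - \<nu> :: 'a radon_measure)"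

definition sgn_radon_measure :: "'a radon_measure \<Rightarrow> 'a radon_measure" where
  "sgn \<mu> = inverse (norm \<mu>) *\<^sub>R (\<mu> :: 'a radon_measure)"

definition uniformity_radon_measure :: "('a radon_measure \<times> 'a radon_measure) filter" where
  "uniformity = (INF e\<in>{0<..}. principal {(\<mu>, \<nu> :: 'a radon_measure). dist \<mu> \<nu> < e})"

definition open_radon_measure :: "'a radon_measure set \<Rightarrow> bool" where
  "open (U :: 'a radon_measure set) \<longleftrightarrow>
     (\<forall>\<mu>\<in>U. eventually (\<lambda>(\<mu>', \<nu>). \<mu>' = \<mu> \<longrightarrow> \<nu> \<in> U) uniformity)"

instance
proof
  fix \<mu> \<nu> \<rho> :: "'a radon_measure" and a b :: real and U :: "'a radon_measure set"
  have ennnorm: "variation (rm_apply \<mu>) UNIV = ennreal (norm \<mu>)" for \<mu> :: "'a radon_measure"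
    unfolding norm_radon_measure_def
    using variation_finite[OF rm_complex_measure, of \<mu> UNIV] by (simp add: less_top)
  have nn: "norm \<mu> \<ge> 0" for \<mu> :: "'a radon_measure"
    by (simp add: norm_radon_measure_def)
  show "\<mu> + \<nu> + \<rho> = \<mu> + (\<nu> + \<rho>)" by transfer (simp add: add.assoc)
  show "\<mu> + \<nu> = \<nu> + \<mu>" by transfer (simp add: add.commute)
  show "0 + \<mu> = \<mu>" by transfer simp
  show "- \<mu> + \<mu> = 0" unfolding uminus_radon_measure_def by transfer simp
  show "\<mu> - \<nu> = \<mu> + - \<nu>" by (simp add: minus_radon_measure_def)
  show "a *\<^sub>R (\<mu> + \<nu>) = a *\<^sub>R \<mu> + a *\<^sub>R \<nu>"
    unfolding scaleR_radon_measure_def by transfer (simp add: algebra_simps)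
  show "(a + b) *\<^sub>R \<mu> = a *\<^sub>R \<mu> + b *\<^sub>R \<mu>"
    unfolding scaleR_radon_measure_def by transfer (simp add: algebra_simps)
  show "a *\<^sub>R b *\<^sub>R \<mu> = (a * b) *\<^sub>R \<mu>"
    unfolding scaleR_radon_measure_def by transfer (simp add: mult.assoc)
  show "1 *\<^sub>R \<mu> = \<mu>"
    unfolding scaleR_radon_measure_def by transfer simp
  show "dist \<mu> \<nu> = norm (\<mu> - \<nu>)" by (rule dist_radon_measure_def)
  show "sgn \<mu> = inverse (norm \<mu>) *\<^sub>R \<mu>" by (rule sgn_radon_measure_def)
  show "uniformity = (INF e\<in>{0<..}. principal {(\<mu>, \<nu> :: 'a radon_measure). dist \<mu> \<nu> < e})"
    by (rule uniformity_radon_measure_def)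
  show "open U \<longleftrightarrow> (\<forall>\<mu>\<in>U. eventually (\<lambda>(\<mu>', \<nu>). \<mu>' = \<mu> \<longrightarrow> \<nu> \<in> U) uniformity)"
    by (rule open_radon_measure_def)
  show "norm \<mu> = 0 \<longleftrightarrow> \<mu> = 0"
  proof
    assume "norm \<mu> = 0"
    then have v: "variation (rm_apply \<mu>) UNIV = 0" using ennnorm by simp
    have "rm_apply \<mu> B = 0" for B
    proof (cases "B \<in> sets borel")
      case True
      then have "ennreal (cmod (rm_apply \<mu> B)) \<le> 0"
        using cmod_le_variation[OF True, of "rm_apply \<mu>"] variation_mono[of B UNIV "rm_apply \<mu>"] v
        by (metis order_trans sets.top space_borel subset_UNIV)
      then show ?thesis by simp
    next
      case False
      then show ?thesis using rm_complex_measure[of \<mu>] by (simp add: complex_measure_def)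
    qed
    then show "\<mu> = 0" by (simp add: rm_apply_inject[symmetric] zero_radon_measure.rep_eq fun_eq_iff)
  next
    assume "\<mu> = 0"
    then show "norm \<mu> = 0"
      using variation_scale[of 0 "\<lambda>_. 0" "UNIV :: 'a set"]
      by (simp add: norm_radon_measure_def zero_radon_measure.rep_eq)
  qed
  show "norm (\<mu> + \<nu>) \<le> norm \<mu> + norm \<nu>"
  proof -
    have "ennreal (norm (\<mu> + \<nu>)) \<le> ennreal (norm \<mu>) + ennreal (norm \<nu>)"
      unfolding ennnorm[symmetric] plus_radon_measure.rep_eq by (rule variation_add_le)
    then show ?thesis
      using nn[of \<mu>] nn[of \<nu>] by (simp add: ennreal_plus[symmetric] del: ennreal_plus)
  qed
  show "norm (a *\<^sub>R \<mu>) = \<bar>a\<bar> * norm \<mu>"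
    unfolding norm_radon_measure_def scaleR_radon_measure_def rm_scale.rep_eq variation_scale
    by (simp add: enn2real_mult)
qed

end

global_interpretation rm: vector_space "rm_scale :: complex \<Rightarrow> 'a::t2_space radon_measure \<Rightarrow> _"
  defines rm_subspace = rm.subspace and rm_span = rm.span
  by standard (transfer; simp add: algebra_simps)+


section \<open>Restrictions, pseudocones and spaceability\<close>

text \<open>Only meaningful for Borel \<open>E\<close>; for other \<open>E\<close> the result is 0.\<close>

lift_definition rm_restrict :: "'a::t2_space radon_measure \<Rightarrow> 'a set \<Rightarrow> 'a radon_measure"
  is "\<lambda>\<mu> E B. if E \<in> sets borel \<and> B \<in> sets borel then \<mu> (B \<inter> E) else 0"
  subgoal for \<mu> E
    using complex_radon_restrict[of \<mu> E] complex_radon_zero by (cases "E \<in> sets borel") auto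
  done

definition restrictions :: "'a::t2_space radon_measure set \<Rightarrow> 'a radon_measure set" where
  "restrictions K = {rm_restrict \<mu> E | \<mu> E. \<mu> \<in> K \<and> E \<in> sets borel}"

definition pseudocone :: "'a::t2_space radon_measure set \<Rightarrow> bool" where
  "pseudocone K \<longleftrightarrow> (\<forall>c. rm_scale c ` K \<subseteq> K)"

text \<open>
  The linear structure is that of \<open>rm_scale\<close>, i.e. over the complex numbers, while \<open>closed\<close> refers
  to the total variation norm.
\<close>

definition spaceable :: "'a::t2_space radon_measure set \<Rightarrow> bool" where
  "spaceable S \<longleftrightarrow> (\<exists>V. rm_subspace V \<and> closed V \<and>
     \<not> (\<exists>F. finite F \<and> V \<subseteq> rm_span F) \<and> V \<subseteq> S \<union> {0})"

end

theory Submission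
  imports Defs
begin

text \<open>
  Pick \<open>\<mu>\<^sub>n\<close> whose restriction to \<open>E\<^sub>n\<close> is not the restriction of an element of
  \<open>restrictions K\<close>. The witnessing subspace consists of the measures that are concentrated on
  the union of the \<open>E\<^sub>n\<close> and are, on each \<open>E\<^sub>n\<close>, a multiple of \<open>\<mu>\<^sub>n\<close>. A nonzero such measure
  has a nonzero multiple of \<open>\<mu>\<^sub>n\<close> on some \<open>E\<^sub>n\<close>; if it were in the pseudocone
  \<open>restrictions K\<close>, so would be its rescaling that agrees with \<open>\<mu>\<^sub>n\<close> on \<open>E\<^sub>n\<close>.
\<close>

lemma rm_apply_not_borel: "B \<notin> sets borel \<Longrightarrow> rm_apply \<mu> B = 0"
  using rm_complex_measure[of \<mu>] by (simp add: complex_measure_def)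

lemma rm_eqI:
  assumes "\<And>B. B \<in> sets borel \<Longrightarrow> rm_apply \<mu> B = rm_apply \<nu> B"
  shows "\<mu> = \<nu>"
  using assms rm_apply_not_borel by (metis ext rm_apply_inject)

lemma rm_apply_empty [simp]: "rm_apply \<mu> {} = 0"
  by (rule complex_measure_empty[OF rm_complex_measure])

lemma rm_apply_restrict:
  "rm_apply (rm_restrict \<mu> E) B =
     (if E \<in> sets borel \<and> B \<in> sets borel then rm_apply \<mu> (B \<inter> E) else 0)"
  by (simp add: rm_restrict.rep_eq)

lemma rm_restrict_UNIV: "rm_restrict \<mu> UNIV = \<mu>"
  by (rule rm_eqI) (simp add: rm_apply_restrict)

lemma rm_restrict_scale: "rm_restrict (rm_scale c \<mu>) E = rm_scale c (rm_restrict \<mu> E)"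
  by (rule rm_eqI) (simp add: rm_apply_restrict rm_scale.rep_eq)

lemma subset_restrictions: "K \<subseteq> restrictions K"
  unfolding restrictions_def using rm_restrict_UNIV
  by (metis (mono_tags, lifting) CollectI sets.top space_borel subsetI)

lemma pseudocone_scale: "pseudocone K \<Longrightarrow> \<mu> \<in> K \<Longrightarrow> rm_scale c \<mu> \<in> K"
  by (auto simp: pseudocone_def)

lemma pseudocone_zero: "pseudocone K \<Longrightarrow> K \<noteq> {} \<Longrightarrow> 0 \<in> K"
  using pseudocone_scale[of K _ 0] by fastforce

lemma pseudocone_restrictions: "pseudocone K \<Longrightarrow> pseudocone (restrictions K)"
  unfolding pseudocone_def restrictions_def
  by (auto simp: rm_restrict_scale[symmetric]) blast

lemma spaceable_mono: "spaceable S \<Longrightarrow> S \<subseteq> T \<Longrightarrow> spaceable T"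
  unfolding spaceable_def by blast

text \<open>Makes evaluation at a fixed set a bounded functional; closedness of the witnessing
  subspace rests on this.\<close>

lemma cmod_rm_apply_le_norm: "cmod (rm_apply \<mu> B) \<le> norm \<mu>"
proof (cases "B \<in> sets borel")
  case True
  have "ennreal (cmod (rm_apply \<mu> B)) \<le> variation (rm_apply \<mu>) UNIV"
    using cmod_le_variation[OF True, of "rm_apply \<mu>"] variation_mono[of B UNIV "rm_apply \<mu>"] True
    by (metis order_trans sets.top space_borel subset_UNIV)
  then show ?thesis
    using variation_finite[OF rm_complex_measure, of \<mu> UNIV]
    unfolding norm_radon_measure_def
    by (metis enn2real_ennreal enn2real_mono infinity_ennreal_def norm_ge_zero)
qed (simp add: rm_apply_not_borel)

lemma bounded_linear_rm_apply: "bounded_linear (\<lambda>\<mu>. rm_apply \<mu> B)"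
  by (rule bounded_linear_intro[where K = 1])
    (simp_all add: plus_radon_measure.rep_eq scaleR_radon_measure_def rm_scale.rep_eq
      scaleR_conv_of_real cmod_rm_apply_le_norm)

lemmas continuous_on_rm_apply =
  bounded_linear.continuous_on[OF bounded_linear_rm_apply continuous_on_id]

text \<open>Countable additivity splits \<open>B\<close> into its traces on the \<open>E n\<close>
  and the remainder outside their union.\<close>

lemma rm_apply_eq_0_decompose:
  assumes E: "disjoint_family E" "\<And>n::nat. E n \<in> sets borel" and B: "B \<in> sets borel"
    and "\<And>n. rm_apply \<mu> (B \<inter> E n) = 0" and "rm_apply \<mu> (B - (\<Union>n. E n)) = 0"
  shows "rm_apply \<mu> B = 0"
proof -
  have U: "(\<Union>n. E n) \<in> sets borel" using E(2) by blast
  have "range (\<lambda>n. B \<inter> E n) \<subseteq> sets borel" "disjoint_family (\<lambda>n. B \<inter> E n)"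
    using E B by (auto simp: disjoint_family_on_def)
  then have "(\<lambda>n. rm_apply \<mu> (B \<inter> E n)) sums rm_apply \<mu> (\<Union>n. B \<inter> E n)"
    using rm_complex_measure[of \<mu>] unfolding complex_measure_def by blast
  then have "rm_apply \<mu> (\<Union>n. B \<inter> E n) = 0"
    using assms(4) sums_unique2[OF sums_zero] by simp
  then have "rm_apply \<mu> (B \<inter> (\<Union>n. E n)) = 0" by simp
  moreover have "rm_apply \<mu> (B \<inter> (\<Union>n. E n) \<union> (B - (\<Union>n. E n))) =
      rm_apply \<mu> (B \<inter> (\<Union>n. E n)) + rm_apply \<mu> (B - (\<Union>n. E n))"
    by (rule complex_measure_Un[OF rm_complex_measure]) (use B U in auto)
  moreover have "B \<inter> (\<Union>n. E n) \<union> (B - (\<Union>n. E n)) = B" by blast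
  ultimately show ?thesis using assms(5) by simp
qed

text \<open>
  Membership is expressed by the equation \<open>\<nu> B * \<mu>\<^sub>n A\<^sub>n = \<nu> A\<^sub>n * \<mu>\<^sub>n B\<close>, which for
  \<open>\<mu>\<^sub>n A\<^sub>n \<noteq> 0\<close> says that \<open>\<nu>\<close> is a multiple of \<open>\<mu>\<^sub>n\<close> on \<open>E\<^sub>n\<close> without mentioning the factor;
  closedness is then immediate from continuity of evaluation at a set.
\<close>

definition piecewise_multiples ::
    "(nat \<Rightarrow> 'a::t2_space set) \<Rightarrow> (nat \<Rightarrow> 'a set) \<Rightarrow> (nat \<Rightarrow> 'a radon_measure) \<Rightarrow> 'a radon_measure set"
  where "piecewise_multiples E A \<mu> =
    {\<nu>. (\<forall>n B. B \<in> sets borel \<longrightarrow> B \<subseteq> E n \<longrightarrow>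
            rm_apply \<nu> B * rm_apply (\<mu> n) (A n) = rm_apply \<nu> (A n) * rm_apply (\<mu> n) B) \<and>
         (\<forall>B. B \<in> sets borel \<longrightarrow> B \<inter> (\<Union>n. E n) = {} \<longrightarrow> rm_apply \<nu> B = 0)}"

lemma subspace_piecewise_multiples: "rm_subspace (piecewise_multiples E A \<mu>)"
  by (rule rm.subspaceI)
    (auto simp: piecewise_multiples_def zero_radon_measure.rep_eq plus_radon_measure.rep_eq
      rm_scale.rep_eq distrib_right mult.assoc)

lemma closed_piecewise_multiples: "closed (piecewise_multiples E A \<mu>)"
  unfolding piecewise_multiples_def
  \<comment> \<open>The premises of the implications do not involve the measure, so they are
    constant and hence open conditions.\<close>
  by (intro closed_Collect_conj closed_Collect_all closed_Collect_imp closed_Collect_eq open_Collect_const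
      continuous_on_mult continuous_on_rm_apply continuous_on_const)

text \<open>Supplies the elements for infinite-dimensionality. On \<open>E m\<close> the defining
  equation is commutativity; on every other \<open>E n\<close> both sides vanish.\<close>

lemma restrict_mem_piecewise_multiples:
  assumes E: "disjoint_family E" "\<And>n. E n \<in> sets borel"
    and A: "\<And>n. A n \<in> sets borel" "\<And>n. A n \<subseteq> E n"
  shows "rm_restrict (\<mu> m) (E m) \<in> piecewise_multiples E A \<mu>"
proof -
  have off: "rm_apply (\<mu> m) (B \<inter> E m) = 0" if "B \<inter> E m = {}" for B
    using that by simp
  have "rm_apply (\<mu> m) (B \<inter> E m) * rm_apply (\<mu> n) (A n) =
      rm_apply (\<mu> m) (A n \<inter> E m) * rm_apply (\<mu> n) B" if B: "B \<subseteq> E n" for n B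
  proof (cases "n = m")
    case True
    then show ?thesis using B A(2)[of m] by (simp add: Int_absorb2)
  next
    case False
    then have "E n \<inter> E m = {}" using E(1) by (simp add: disjoint_family_on_def)
    then have "B \<inter> E m = {}" "A n \<inter> E m = {}" using B A(2)[of n] by blast+
    then show ?thesis using off by simp
  qed
  moreover have "rm_apply (\<mu> m) (B \<inter> E m) = 0" if "B \<inter> (\<Union>n. E n) = {}" for B
    using that by (intro off) blast
  ultimately show ?thesis
    using E(2) A(1) by (simp add: piecewise_multiples_def rm_apply_restrict)
qed

text \<open>The restrictions of the \<open>\<mu> n\<close> to \<open>E n\<close> are infinitely many
  independent elements, with the evaluations at \<open>A n\<close> as a dual system up to nonzero
  factors.\<close>

lemma infinite_dim_piecewise_multiples:
  assumes E: "disjoint_family E" "\<And>n. E n \<in> sets borel"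
    and A: "\<And>n. A n \<in> sets borel" "\<And>n. A n \<subseteq> E n" "\<And>n. rm_apply (\<mu> n) (A n) \<noteq> 0"
    and F: "finite F"
  shows "\<not> piecewise_multiples E A \<mu> \<subseteq> rm_span F"
proof
  assume sub: "piecewise_multiples E A \<mu> \<subseteq> rm_span F"
  define r where "r n = rm_restrict (\<mu> n) (E n)" for n
  have diag: "rm_apply (r n) (A n) \<noteq> 0" for n
    using A E(2) by (simp add: r_def rm_apply_restrict Int_absorb2)
  have off: "rm_apply (r n) (A m) = 0" if "n \<noteq> m" for m n
  proof -
    have "A m \<inter> E n = {}" using that A(2)[of m] E(1) by (fastforce simp: disjoint_family_on_def)
    then show ?thesis by (simp add: r_def rm_apply_restrict)
  qed
  have "inj r" using diag off by (metis injI)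
  moreover have "rm.independent (range r)"
    unfolding rm.dependent_def
  proof
    assume "\<exists>a\<in>range r. a \<in> rm_span (range r - {a})"
    then obtain n where n: "r n \<in> rm_span (range r - {r n})" by blast
    \<comment> \<open>The kernel of evaluation at \<open>A n\<close> contains the span of the other
      \<open>r k\<close>, but not \<open>r n\<close>.\<close>
    have "rm_subspace {\<nu>. rm_apply \<nu> (A n) = 0}"
      by (rule rm.subspaceI)
        (simp_all add: zero_radon_measure.rep_eq plus_radon_measure.rep_eq rm_scale.rep_eq)
    moreover have "range r - {r n} \<subseteq> {\<nu>. rm_apply \<nu> (A n) = 0}"
    proof
      fix \<nu> assume "\<nu> \<in> range r - {r n}"
      then obtain k where "\<nu> = r k" "k \<noteq> n" by auto
      then show "\<nu> \<in> {\<nu>. rm_apply \<nu> (A n) = 0}" using off[of k n] by simp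
    qed
    ultimately have "rm_span (range r - {r n}) \<subseteq> {\<nu>. rm_apply \<nu> (A n) = 0}"
      by (intro rm.span_minimal)
    then show False using n diag by blast
  qed
  moreover have "range r \<subseteq> rm_span F"
    using sub restrict_mem_piecewise_multiples[OF E A(1,2)] unfolding r_def by blast
  ultimately show False
    using rm.independent_span_bound[OF F] finite_imageD[of r UNIV] by auto
qed

text \<open>If \<open>\<nu>\<close> vanishes at every \<open>A n\<close>, the defining equation,
  divided by the nonzero \<open>\<mu> n\<close> value at \<open>A n\<close>, makes it vanish on all
  Borel subsets of each \<open>E n\<close>, and so everywhere.\<close>

lemma piecewise_multiples_nonzero:
  assumes E: "disjoint_family E" "\<And>n. E n \<in> sets borel"
    and A: "\<And>n. rm_apply (\<mu> n) (A n) \<noteq> 0"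
    and \<nu>: "\<nu> \<in> piecewise_multiples E A \<mu>" "\<nu> \<noteq> 0"
  obtains n where "rm_apply \<nu> (A n) \<noteq> 0"
proof (rule ccontr)
  assume "\<not> thesis"
  then have z: "rm_apply \<nu> (A n) = 0" for n using that by blast
  have "\<nu> = 0"
  proof (rule rm_eqI)
    fix B :: "'a set" assume B: "B \<in> sets borel"
    have "rm_apply \<nu> (B \<inter> E n) * rm_apply (\<mu> n) (A n) = 0" for n
      using \<nu>(1) B E(2)[of n] z[of n] by (simp add: piecewise_multiples_def)
    then have "rm_apply \<nu> (B \<inter> E n) = 0" for n using A by simp
    moreover have "rm_apply \<nu> (B - (\<Union>n. E n)) = 0"
    proof -
      have "B - (\<Union>n. E n) \<in> sets borel" using B E(2) by blast
      moreover have "(B - (\<Union>n. E n)) \<inter> (\<Union>n. E n) = {}" by blast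
      ultimately show ?thesis using \<nu>(1) unfolding piecewise_multiples_def by blast
    qed
    ultimately show "rm_apply \<nu> B = rm_apply 0 B"
      using rm_apply_eq_0_decompose[OF E B] by (simp add: zero_radon_measure.rep_eq)
  qed
  then show False using \<nu>(2) by simp
qed

lemma spaceable_Compl_pseudocone:
  fixes S :: "'a::t2_space radon_measure set" and E :: "nat \<Rightarrow> 'a set"
  assumes S: "pseudocone S" "S \<noteq> {}"
    and E: "disjoint_family E" "\<And>n. E n \<in> sets borel"
    and ne: "\<And>n. \<exists>\<mu>. \<forall>\<nu>\<in>S. rm_restrict \<nu> (E n) \<noteq> rm_restrict \<mu> (E n)"
  shows "spaceable (UNIV - S)"
proof -
  obtain \<mu> where \<mu>: "\<And>n \<nu>. \<nu> \<in> S \<Longrightarrow> rm_restrict \<nu> (E n) \<noteq> rm_restrict (\<mu> n) (E n)"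
    using ne by metis
  \<comment> \<open>Otherwise \<open>\<mu> n\<close> and 0 have the same restriction to
    \<open>E n\<close>, although 0 lies in the nonempty pseudocone \<open>S\<close>.\<close>
  have "\<exists>A. A \<in> sets borel \<and> A \<subseteq> E n \<and> rm_apply (\<mu> n) A \<noteq> 0" for n
  proof (rule ccontr)
    assume "\<not> ?thesis"
    then have "rm_apply (\<mu> n) (B \<inter> E n) = 0" if "B \<in> sets borel" for B
      using that E(2)[of n] by blast
    then have "rm_restrict 0 (E n) = rm_restrict (\<mu> n) (E n)"
      by (intro rm_eqI) (simp add: rm_apply_restrict zero_radon_measure.rep_eq)
    then show False using \<mu> pseudocone_zero[OF S] by blast
  qed
  then obtain A where
    A: "\<And>n. A n \<in> sets borel" "\<And>n. A n \<subseteq> E n" "\<And>n. rm_apply (\<mu> n) (A n) \<noteq> 0"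
    by metis
  have "\<nu> \<notin> S" if \<nu>: "\<nu> \<in> piecewise_multiples E A \<mu>" "\<nu> \<noteq> 0" for \<nu>
  proof
    assume "\<nu> \<in> S"
    obtain n where n: "rm_apply \<nu> (A n) \<noteq> 0"
      using piecewise_multiples_nonzero[OF E A(3) \<nu>] .
    \<comment> \<open>This factor makes \<open>c\<close> times \<open>\<nu>\<close> agree with
      \<open>\<mu> n\<close> at \<open>A n\<close>; the defining equation extends the agreement to
      all Borel subsets of \<open>E n\<close>.\<close>
    define c where "c = rm_apply (\<mu> n) (A n) / rm_apply \<nu> (A n)"
    have "rm_restrict (rm_scale c \<nu>) (E n) = rm_restrict (\<mu> n) (E n)"
    proof (rule rm_eqI)
      fix B :: "'a set" assume B: "B \<in> sets borel"
      have "rm_apply \<nu> (B \<inter> E n) * rm_apply (\<mu> n) (A n) =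
          rm_apply \<nu> (A n) * rm_apply (\<mu> n) (B \<inter> E n)"
        using \<nu>(1) B E(2)[of n] by (simp add: piecewise_multiples_def)
      then show "rm_apply (rm_restrict (rm_scale c \<nu>) (E n)) B =
          rm_apply (rm_restrict (\<mu> n) (E n)) B"
        using B E(2) n by (simp add: rm_apply_restrict rm_scale.rep_eq c_def field_simps)
    qed
    then show False using \<mu> pseudocone_scale[OF S(1) \<open>\<nu> \<in> S\<close>] by blast
  qed
  then have "piecewise_multiples E A \<mu> \<subseteq> UNIV - S \<union> {0}" by blast
  moreover have "\<not> (\<exists>F. finite F \<and> piecewise_multiples E A \<mu> \<subseteq> rm_span F)"
    using infinite_dim_piecewise_multiples[OF E A] by simp
  ultimately show ?thesis
    unfolding spaceable_def
    by (intro exI[of _ "piecewise_multiples E A \<mu>"] conjI subspace_piecewise_multiples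
        closed_piecewise_multiples)
qed

theorem proposition5p4:
  fixes K :: "'a::t2_space radon_measure set" and E :: "nat \<Rightarrow> 'a set"
  assumes "locally_compact_space (euclidean :: 'a topology)"
    and "pseudocone K" and "K \<noteq> {}"
    and "disjoint_family E" and "\<And>n. E n \<in> sets borel"
    and "\<And>n. {rm_restrict \<mu> (E n) | \<mu>. \<mu> \<in> restrictions K} \<noteq> {rm_restrict \<mu> (E n) | \<mu>. \<mu> \<in> UNIV}"
  shows "spaceable (UNIV - restrictions K) \<and> spaceable (UNIV - K)"
proof -
  have "spaceable (UNIV - restrictions K)"
  proof (rule spaceable_Compl_pseudocone[OF pseudocone_restrictions[OF assms(2)] _ assms(4,5)])
    show "restrictions K \<noteq> {}" using assms(3) subset_restrictions by blast
    show "\<exists>\<mu>. \<forall>\<nu>\<in>restrictions K. rm_restrict \<nu> (E n) \<noteq> rm_restrict \<mu> (E n)" for n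
    proof (rule ccontr)
      assume "\<not> ?thesis"
      then have "\<forall>\<mu>. \<exists>\<nu>\<in>restrictions K. rm_restrict \<mu> (E n) = rm_restrict \<nu> (E n)"
        by metis
      \<comment> \<open>The reverse inclusion is trivial, so this one would make the two sets
        equal.\<close>
      then have "{rm_restrict \<mu> (E n) | \<mu>. \<mu> \<in> UNIV} \<subseteq> {rm_restrict \<mu> (E n) | \<mu>. \<mu> \<in> restrictions K}"
        by blast
      then show False using assms(6)[of n] by blast
    qed
  qed
  moreover from this have "spaceable (UNIV - K)"
    by (rule spaceable_mono) (use subset_restrictions in blast)
  ultimately show ?thesis ..
qed

end
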